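(* Let $\mathcal Q(\mathbb R)=\{(z,w)\in\mathbb C^2:2\,\mathrm{Re}\,z-|w|^2=0\}$, endowed with the Lie group law $(z,w)\cdot(z',w')=(z+z'+w'\bar w,\,w+w')$, and let $\mathcal Q(\mathbb Q)=\mathcal Q(\mathbb R)\cap\mathbb Q(i)^2$. For $r=(p/q,p'/q)\in\mathcal Q(\mathbb Q)$ with $p,p',q\in\mathbb Z[i]$ relatively prime, let $h(r)=|q|$. Let $d'_{\mathrm{Cyg}}$ be the left-invariant distance on $\mathcal Q(\mathbb R)$ such that $d'_{\mathrm{Cyg}}((z,w),(0,0))=\sqrt{2|z|+|w|^2}$. For every $x\in\mathcal Q(\mathbb R)-\mathcal Q(\mathbb Q)$, let $$c(x)=\liminf_{r\in\mathcal Q(\mathbb Q),\ h(r)\to\infty}h(r)\,d'_{\mathrm{Cyg}}(x,r),$$ and let $\mathrm{Sp}_{\mathrm{Lag}}$ be the set of real numbers of the form $c(x)$ for some $x\in\mathcal Q(\mathbb R)-\mathcal Q(\mathbb Q)$. Then $\mathrm{Sp}_{\mathrm{Lag}}$ contains the interval $[0,0.047]$. *)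

theory Defs
  imports "HOL-Analysis.Analysis"
begin

definition QR :: "(complex \<times> complex) set" where
  "QR = {(z, w). 2 * Re z - (cmod w)^2 = 0}"

definition qmult :: "complex \<times> complex \<Rightarrow> complex \<times> complex \<Rightarrow> complex \<times> complex" where
  "qmult x y = (fst x + fst y + snd y * cnj (snd x), snd x + snd y)"

definition qinv :: "complex \<times> complex \<Rightarrow> complex \<times> complex" where
  "qinv x = (complex_of_real ((cmod (snd x))^2) - fst x, - snd x)"

definition gauss_int :: "complex \<Rightarrow> bool" where
  "gauss_int z \<longleftrightarrow> Re z \<in> \<int> \<and> Im z \<in> \<int>"

definition gauss_rat :: "complex \<Rightarrow> bool" where
  "gauss_rat z \<longleftrightarrow> Re z \<in> \<rat> \<and> Im z \<in> \<rat>"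

definition gdvd :: "complex \<Rightarrow> complex \<Rightarrow> bool" where
  "gdvd d a \<longleftrightarrow> (\<exists>k. gauss_int k \<and> a = d * k)"

definition gcoprime3 :: "complex \<Rightarrow> complex \<Rightarrow> complex \<Rightarrow> bool" where
  "gcoprime3 p p' q \<longleftrightarrow>
     (\<forall>d. gauss_int d \<and> gdvd d p \<and> gdvd d p' \<and> gdvd d q \<longrightarrow> gdvd d 1)"

definition QQ :: "(complex \<times> complex) set" where
  "QQ = {r \<in> QR. gauss_rat (fst r) \<and> gauss_rat (snd r)}"

definition height :: "complex \<times> complex \<Rightarrow> real" where
  "height r = (THE t. \<exists>p p' q. gauss_int p \<and> gauss_int p' \<and> gauss_int q \<and> q \<noteq> 0
       \<and> gcoprime3 p p' q \<and> r = (p / q, p' / q) \<and> t = cmod q)"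

definition cyg_gauge :: "complex \<times> complex \<Rightarrow> real" where
  "cyg_gauge x = sqrt (2 * cmod (fst x) + (cmod (snd x))^2)"

definition dcyg :: "complex \<times> complex \<Rightarrow> complex \<times> complex \<Rightarrow> real" where
  "dcyg x y = cyg_gauge (qmult (qinv y) x)"

definition lag_c :: "complex \<times> complex \<Rightarrow> ereal" where
  "lag_c x = (SUP T::real. INF r \<in> {r \<in> QQ. height r \<ge> T}. ereal (height r * dcyg x r))"

definition Sp_Lag :: "real set" where
  "Sp_Lag = {c. \<exists>x \<in> QR - QQ. lag_c x = ereal c}"

end

theory Submission
  imports Defs "HOL-Library.Discrete_Functions"
begin

text \<open>
  Take \<open>x = (i t, 0)\<close> on the vertical chain. Rational points off the chain satisfy
  \<open>h(r) d(x, r) \<ge> \<surd>2\<close>, and for \<open>r = (i a / b, 0)\<close> in lowest terms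
  \<open>h(r) d(x, r) = \<surd>(2 b \<bar>b t - a\<bar>)\<close>. So it suffices to realise every
  \<open>\<mu> \<in> [0, 1/74]\<close> as \<open>lim inf b \<bar>b t - a\<bar>\<close> for some irrational \<open>t\<close>, a weak form of
  Hall's theorem on the classical Lagrange spectrum.

  Along the continued fraction of \<open>t\<close> with digits \<open>d n\<close>, this lower limit is that of
  \<open>1 / (d n + [0; d (n + 1), \<dots>] + [0; d (n - 1), \<dots>, d 0])\<close>.
  Instead of adding Cantor sets, a nested interval argument writes \<open>1 / \<mu>\<close> as a sum of two
  badly approximable numbers, whose digits are at most 72. Their fractional parts are
  \<open>[0; a]\<close> and \<open>[0; b]\<close>, and the integer parts add up to \<open>A\<close>. The digits of \<open>t\<close> contain
  longer and longer blocks consisting of \<open>b\<close> reversed, then \<open>A\<close>, then \<open>a\<close>.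
\<close>

section \<open>Continued fractions\<close>

text \<open>\<open>\<theta> n\<close> is the tail \<open>[0; d n, d (n + 1), \<dots>]\<close>.
  Characterising tails by their recursion lets one locale serve expansions built from a number and
  from digits.\<close>

locale cfrac =
  fixes d :: "nat \<Rightarrow> nat" and \<theta> :: "nat \<Rightarrow> real"
  assumes d_pos: "1 \<le> d n"
    and th_pos: "0 < \<theta> n"
    and th_less: "\<theta> n < 1"
    and th_rec: "\<theta> n * (real (d n) + \<theta> (Suc n)) = 1"
begin

text \<open>The indices are shifted by one: \<open>P n\<close> and \<open>Q n\<close> are the classical
  \<open>p\<^sub>n\<^sub>-\<^sub>1\<close> and \<open>q\<^sub>n\<^sub>-\<^sub>1\<close>, and \<open>P (n + 1) / Q (n + 1)\<close> is
  \<open>[0; d 0, \<dots>, d (n - 1)]\<close>.\<close>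

fun P :: "nat \<Rightarrow> int" where
  "P 0 = 1" | "P (Suc 0) = 0" | "P (Suc (Suc n)) = int (d n) * P (Suc n) + P n"

fun Q :: "nat \<Rightarrow> int" where
  "Q 0 = 0" | "Q (Suc 0) = 1" | "Q (Suc (Suc n)) = int (d n) * Q (Suc n) + Q n"

definition E :: "nat \<Rightarrow> real" where
  "E n = real_of_int (Q n) * \<theta> 0 - real_of_int (P n)"

text \<open>This ratio is \<open>[0; d (n - 1), \<dots>, d 0]\<close>, the past digits read
  backwards.\<close>

definition R :: "nat \<Rightarrow> real" where
  "R n = real_of_int (Q n) / real_of_int (Q (Suc n))"

section \<open>Convergents: denominators, errors and best approximation\<close>

lemma Q_nonneg: "0 \<le> Q n" and Q_Suc_pos: "0 < Q (Suc n)"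
proof -
  have "0 \<le> Q n \<and> 0 < Q (Suc n)"
  proof (induction n)
    case (Suc n)
    have "0 < int (d n) * Q (Suc n)"
      using Suc d_pos[of n] by (intro mult_pos_pos) auto
    then show ?case using Suc by auto
  qed auto
  then show "0 \<le> Q n" "0 < Q (Suc n)" by auto
qed

lemma Q_step: "Q (Suc n) + Q n \<le> Q (Suc (Suc n))"
proof -
  have "1 * Q (Suc n) \<le> int (d n) * Q (Suc n)"
    using d_pos[of n] Q_Suc_pos[of n] by (intro mult_right_mono) auto
  then show ?thesis by simp
qed

lemma Q_mono_Suc: "Q n \<le> Q (Suc n)"
  using Q_step[of "n - 1"] Q_nonneg[of "n - 1"] by (cases n) auto

lemma Q_mono: "m \<le> n \<Longrightarrow> Q m \<le> Q n"
  by (rule lift_Suc_mono_le[of Q, OF Q_mono_Suc])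

lemma Q_ge: "int n \<le> Q (Suc n)"
proof (induction n)
  case (Suc n)
  show ?case
  \<comment> \<open>The step gains \<open>Q n\<close>, which vanishes for \<open>n = 0\<close>, so
    that case is separate.\<close>
  proof (cases n)
    case 0
    then show ?thesis using Q_step[of 0] by simp
  next
    case (Suc m)
    then show ?thesis using Suc.IH Q_step[of n] Q_Suc_pos[of m] by (simp del: Q.simps)
  qed
qed auto

lemma det: "P (Suc n) * Q n - P n * Q (Suc n) = - ((-1) ^ n)"
proof (induction n)
  case (Suc n)
  have "P (Suc (Suc n)) * Q (Suc n) - P (Suc n) * Q (Suc (Suc n))
      = - (P (Suc n) * Q n - P n * Q (Suc n))"
    by (simp add: algebra_simps)
  then show ?case using Suc by simp
qed auto

lemma coprime_P_Q: "coprime (P (Suc n)) (Q (Suc n))"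
proof (rule coprimeI)
  fix c assume "c dvd P (Suc n)" "c dvd Q (Suc n)"
  then have "c dvd P (Suc n) * Q n - P n * Q (Suc n)" by simp
  then show "is_unit c"
    unfolding det by (cases "even n") auto
qed

text \<open>The errors obey the same three-term recurrence as \<open>P\<close> and \<open>Q\<close>;
  the relation for \<open>\<theta>\<close> reduces it to first order, so signs alternate.\<close>

lemma E_rec: "E (Suc n) = - \<theta> n * E n"
proof (induction n)
  case 0
  then show ?case by (simp add: E_def)
next
  case (Suc n)
  have "E (Suc (Suc n)) = real (d n) * E (Suc n) + E n"
    by (simp add: E_def algebra_simps)
  also have "E n = \<theta> n * (real (d n) + \<theta> (Suc n)) * E n" by (simp add: th_rec)
  also have "\<dots> = - (real (d n) + \<theta> (Suc n)) * E (Suc n)"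
    unfolding Suc by (simp add: algebra_simps)
  finally show ?case by (simp add: algebra_simps)
qed

lemma E_sgn: "0 < - ((-1) ^ n * E n)"
proof (induction n)
  case 0
  then show ?case by (simp add: E_def)
next
  case (Suc n)
  have "0 < \<theta> n * (- ((-1) ^ n * E n))" using Suc th_pos by (rule mult_pos_pos[rotated])
  then show ?case by (simp add: E_rec algebra_simps)
qed

lemma abs_E: "\<bar>E n\<bar> = - ((-1) ^ n * E n)"
proof -
  have "\<bar>E n\<bar> = \<bar>- ((-1) ^ n * E n)\<bar>" by (simp add: abs_mult power_abs)
  also have "\<dots> = - ((-1) ^ n * E n)" using E_sgn[of n] by linarith
  finally show ?thesis .
qed

lemma abs_E_pos: "0 < \<bar>E n\<bar>"
  using E_sgn abs_E by simp

lemma abs_E_Suc: "\<bar>E (Suc n)\<bar> = \<theta> n * \<bar>E n\<bar>"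
  using th_pos[of n] by (simp add: E_rec abs_mult)

text \<open>Consecutive errors have opposite signs, so this sum is the determinant up to
  sign.\<close>

lemma Q_E_sum: "real_of_int (Q (Suc n)) * \<bar>E n\<bar> + real_of_int (Q n) * \<bar>E (Suc n)\<bar> = 1"
proof -
  have "real_of_int (Q (Suc n)) * \<bar>E n\<bar> + real_of_int (Q n) * \<bar>E (Suc n)\<bar>
      = - ((-1) ^ n * (real_of_int (Q (Suc n)) * E n - real_of_int (Q n) * E (Suc n)))"
    unfolding abs_E by (simp add: algebra_simps)
  also have "real_of_int (Q (Suc n)) * E n - real_of_int (Q n) * E (Suc n)
      = real_of_int (P (Suc n) * Q n - P n * Q (Suc n))"
    by (simp add: E_def algebra_simps)
  also have "\<dots> = - ((-1) ^ n)" unfolding det by simp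
  finally show ?thesis by (simp add: flip: power_mult_distrib)
qed

lemma R_nonneg: "0 \<le> R n" and R_le: "R n \<le> 1"
  using Q_nonneg[of n] Q_Suc_pos[of n] Q_mono_Suc[of n] by (auto simp: R_def)

lemma R_Suc: "R (Suc n) = 1 / (real (d n) + R n)"
  using Q_Suc_pos[of n] by (simp add: R_def field_simps)

text \<open>Perron's formula: dividing \<open>Q_E_sum\<close> by the left side leaves the summands
  \<open>1 / \<theta> n\<close> and \<open>R n\<close>.\<close>

lemma Q_times_E: "real_of_int (Q (Suc n)) * \<bar>E (Suc n)\<bar> = 1 / (real (d n) + \<theta> (Suc n) + R n)"
proof -
  have q: "0 < real_of_int (Q (Suc n))" using Q_Suc_pos[of n] by simp
  have th: "real (d n) + \<theta> (Suc n) = 1 / \<theta> n"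
    using th_rec[of n] th_pos[of n] by (simp add: field_simps)
  have "real_of_int (Q (Suc n)) * \<bar>E (Suc n)\<bar> * (1 / \<theta> n + R n) =
      real_of_int (Q (Suc n)) * \<bar>E n\<bar> + real_of_int (Q n) * \<bar>E (Suc n)\<bar>"
    using q th_pos[of n] by (simp add: R_def abs_E_Suc field_simps)
  then have "real_of_int (Q (Suc n)) * \<bar>E (Suc n)\<bar> * (1 / \<theta> n + R n) = 1"
    by (simp only: Q_E_sum)
  moreover have "0 < 1 / \<theta> n + R n"
    using th_pos[of n] R_nonneg[of n] by (simp add: add_pos_nonneg)
  ultimately show ?thesis unfolding th by (simp add: field_simps)
qed

text \<open>The range of \<open>b\<close> forces its two coordinates in the basis of consecutive
  convergents to have no common sign, and the first to be nonzero, so their contributions to the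
  error cannot cancel.\<close>

lemma best_approximation:
  assumes "0 < b" "b < Q (Suc n)"
  shows "\<bar>E n\<bar> \<le> \<bar>real_of_int b * \<theta> 0 - real_of_int a\<bar>"
proof -
  \<comment> \<open>Cramer's rule: \<open>u\<close> and \<open>v\<close> are the coordinates of
    \<open>(-b, -a)\<close> in the basis \<open>(Q n, P n)\<close>,
    \<open>(Q (Suc n), P (Suc n))\<close>, whose determinant is a unit.\<close>
  define u where "u = (-1) ^ n * (b * P (Suc n) - a * Q (Suc n))"
  define v where "v = (-1) ^ n * (a * Q n - b * P n)"
  have sq: "(-1) ^ n * (-1) ^ n = (1::int)" by (simp flip: power_mult_distrib)
  have dt: "P n * Q (Suc n) - P (Suc n) * Q n = (-1) ^ n" using det[of n] by simp
  have "u * Q n + v * Q (Suc n) = - ((-1) ^ n * b * (P n * Q (Suc n) - P (Suc n) * Q n))"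
    by (simp add: u_def v_def algebra_simps)
  then have b: "- b = u * Q n + v * Q (Suc n)"
    unfolding dt using sq by (simp add: algebra_simps)
  have "u * P n + v * P (Suc n) = - ((-1) ^ n * a * (P n * Q (Suc n) - P (Suc n) * Q n))"
    by (simp add: u_def v_def algebra_simps)
  then have a: "- a = u * P n + v * P (Suc n)"
    unfolding dt using sq by (simp add: algebra_simps)
  have "- (real_of_int b * \<theta> 0 - real_of_int a) = real_of_int (- b) * \<theta> 0 - real_of_int (- a)"
    by simp
  also have "\<dots> = real_of_int u * E n + real_of_int v * E (Suc n)"
    unfolding a b by (simp add: E_def algebra_simps)
  also have "\<dots> = (real_of_int u - real_of_int v * \<theta> n) * E n"
    by (simp add: E_rec algebra_simps)
  finally have eq: "\<bar>real_of_int b * \<theta> 0 - real_of_int a\<bar> = \<bar>real_of_int u - real_of_int v * \<theta> n\<bar> * \<bar>E n\<bar>"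
    by (metis abs_minus_cancel abs_mult)
  have "1 \<le> \<bar>real_of_int u - real_of_int v * \<theta> n\<bar>"
  proof (cases "v \<le> 0")
    case True
    have "u \<noteq> 0 \<or> v \<noteq> 0" using assms b by auto
    moreover have "False" if "u \<le> 0" "v < 0"
    proof -
      have "u * Q n \<le> 0" using that Q_nonneg[of n] by (simp add: mult_nonpos_nonneg)
      moreover have "v * Q (Suc n) \<le> (-1) * Q (Suc n)"
        using that Q_Suc_pos[of n] by (intro mult_right_mono) auto
      ultimately show False using assms b by simp
    qed
    ultimately consider "0 < u" | "v = 0" "u < 0" using True by (metis linorder_neqE_linordered_idom nle_le order_le_less)
    then show ?thesis
    proof cases
      case 1
      have "real_of_int v * \<theta> n \<le> 0" using True th_pos[of n] by (simp add: mult_nonpos_nonneg)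
      moreover have "1 \<le> real_of_int u" using 1 by simp
      ultimately show ?thesis by linarith
    next
      case 2
      then have "real_of_int u \<le> -1" by linarith
      then show ?thesis using 2 by simp
    qed
  next
    case False
    have "u < 0"
    proof (rule ccontr)
      assume "\<not> u < 0"
      then have "0 \<le> u * Q n + v * Q (Suc n)"
        using False Q_nonneg[of n] Q_nonneg[of "Suc n"] by simp
      then show False using assms b by simp
    qed
    then have "real_of_int u \<le> -1" by linarith
    moreover have "0 \<le> real_of_int v * \<theta> n" using False th_pos[of n] by simp
    ultimately show ?thesis by linarith
  qed
  then show ?thesis unfolding eq using mult_right_mono[of 1 _ "\<bar>E n\<bar>"] by simp
qed

text \<open>Place \<open>b\<close> between consecutive denominators,
  \<open>Q (Suc n) \<le> b < Q (Suc (Suc n))\<close>: both factors then dominate those of the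
  convergent, whose value is \<open>Q_times_E\<close>.\<close>

lemma approximation_lower_bound:
  assumes "Q (Suc N) \<le> b" and low: "\<And>n. N \<le> n \<Longrightarrow> \<mu> \<le> 1 / (real (d n) + \<theta> (Suc n) + R n)"
  shows "\<mu> \<le> real_of_int b * \<bar>real_of_int b * \<theta> 0 - real_of_int a\<bar>"
proof -
  have "\<exists>n. b < Q (Suc n)"
    using Q_ge[of "Suc (nat b)"] by (intro exI[of _ "Suc (nat b)"]) linarith
  define m where "m = (LEAST n. b < Q (Suc n))"
  have m: "b < Q (Suc m)" unfolding m_def by (rule LeastI_ex) fact
  have b: "0 < b" using assms(1) Q_Suc_pos[of N] by simp
  have "N < m" using m assms(1) Q_mono[of "Suc m" "Suc N"] by force
  then obtain n where n: "m = Suc n" "N \<le> n" by (cases m) auto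
  have le: "Q (Suc n) \<le> b"
    using not_less_Least[of n "\<lambda>n. b < Q (Suc n)"] n unfolding m_def by force
  have "\<mu> \<le> real_of_int (Q (Suc n)) * \<bar>E (Suc n)\<bar>"
    unfolding Q_times_E using low n by simp
  also have "\<dots> \<le> real_of_int b * \<bar>real_of_int b * \<theta> 0 - real_of_int a\<bar>"
    using le b m best_approximation[of b m a] n by (intro mult_mono) auto
  finally show ?thesis .
qed

lemma irrational: "\<theta> 0 \<notin> \<rat>"
proof
  assume "\<theta> 0 \<in> \<rat>"
  then obtain a b :: int where ab: "0 < b" "\<theta> 0 = of_int a / of_int b"
    by (metis Rats_cases')
  have "b < Q (Suc (Suc (nat b)))" using Q_ge[of "Suc (nat b)"] by linarith
  from best_approximation[OF ab(1) this, of a] abs_E_pos[of "Suc (nat b)"] ab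
  show False by simp
qed

end

section \<open>Existence of expansions and their stability under changes of the tail\<close>

lemma cfrac_exists_of_irrational:
  assumes "x \<notin> \<rat>" "0 < x" "x < 1"
  obtains d \<theta> where "cfrac d \<theta>" "\<theta> 0 = x"
proof -
  \<comment> \<open>The orbit of \<open>x\<close> under the Gauss map; irrationality keeps it away
    from 0.\<close>
  define \<theta> where "\<theta> n = ((\<lambda>y. frac (1 / y)) ^^ n) x" for n
  define d where "d n = nat \<lfloor>1 / \<theta> n\<rfloor>" for n
  have suc: "\<theta> (Suc n) = frac (1 / \<theta> n)" for n by (simp add: \<theta>_def)
  have th: "\<theta> n \<notin> \<rat> \<and> 0 < \<theta> n \<and> \<theta> n < 1" for n
  proof (induction n)
    case 0
    then show ?case using assms by (simp add: \<theta>_def)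
  next
    case (Suc n)
    have "1 / \<theta> n \<notin> \<rat>"
      using Suc Rats_inverse[of "inverse (\<theta> n)"] by (auto simp: divide_inverse)
    then have "\<theta> (Suc n) \<notin> \<rat>"
      unfolding suc frac_def
      by (metis Rats_add Rats_of_int diff_add_cancel)
    moreover have "0 \<le> \<theta> (Suc n)" "\<theta> (Suc n) < 1" unfolding suc by (auto simp: frac_lt_1)
    moreover have "\<theta> (Suc n) \<noteq> 0" using calculation by auto
    ultimately show ?case by simp
  qed
  have fl: "1 \<le> \<lfloor>1 / \<theta> n\<rfloor>" for n using th[of n] by (simp add: le_floor_iff)
  have "cfrac d \<theta>"
  proof
    fix n
    show "1 \<le> d n" using fl[of n] unfolding d_def by linarith
    show "0 < \<theta> n" "\<theta> n < 1" using th[of n] by auto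
    have "real (d n) + \<theta> (Suc n) = 1 / \<theta> n"
      using order.trans[OF zero_le_one fl[of n]] by (simp add: d_def suc frac_def of_nat_nat)
    then show "\<theta> n * (real (d n) + \<theta> (Suc n)) = 1" using th[of n] by simp
  qed
  moreover have "\<theta> 0 = x" by (simp add: \<theta>_def)
  ultimately show ?thesis by (rule that)
qed

text \<open>For positive \<open>k\<close> this is \<open>[0; a 0, \<dots>, a (k - 1) + x]\<close>, a
  truncation with a free real tail.\<close>

fun cfk :: "(nat \<Rightarrow> nat) \<Rightarrow> nat \<Rightarrow> real \<Rightarrow> real" where
  "cfk a 0 x = x"
| "cfk a (Suc k) x = 1 / (real (a 0) + cfk (\<lambda>i. a (Suc i)) k x)"

lemma cfk_bounds:
  assumes "\<And>i. 1 \<le> a i" "0 \<le> x" "x \<le> 1"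
  shows "0 \<le> cfk a k x \<and> cfk a k x \<le> 1"
  using assms(1)
proof (induction k arbitrary: a)
  case (Suc k)
  have "0 \<le> cfk (\<lambda>i. a (Suc i)) k x"
    using Suc.IH[of "\<lambda>i. a (Suc i)"] Suc.prems by simp
  moreover have "1 \<le> real (a 0)" using Suc.prems[of 0] by simp
  ultimately show ?case by simp
qed (use assms in auto)

text \<open>The product \<open>(a + x) * (a + y)\<close> is at least \<open>1 + |x - y|\<close>. For
  \<open>a = 1\<close> there is no uniform contraction factor, but
  \<open>\<delta> / (1 + \<delta>)\<close> maps \<open>1 / (k + 1)\<close> to
  \<open>1 / (k + 2)\<close>, which iterates well.\<close>

lemma inverse_shift_contraction:
  fixes x y \<delta> a :: real
  assumes "0 \<le> x" "0 \<le> y" "1 \<le> a" "\<bar>x - y\<bar> \<le> \<delta>"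
  shows "\<bar>1 / (a + x) - 1 / (a + y)\<bar> \<le> \<delta> / (1 + \<delta>)"
proof -
  let ?e = "\<bar>x - y\<bar>"
  have "1 + ?e \<le> 1 * 1 + 1 * x + 1 * y" using assms by linarith
  also have "\<dots> \<le> a * a + a * x + a * y"
    using assms by (intro add_mono mult_mono) auto
  also have "\<dots> \<le> (a + x) * (a + y)" using assms by (simp add: algebra_simps)
  finally have le: "1 + ?e \<le> (a + x) * (a + y)" .
  have "1 / (a + x) - 1 / (a + y) = (y - x) / ((a + x) * (a + y))"
    using assms by (simp add: field_simps)
  then have "\<bar>1 / (a + x) - 1 / (a + y)\<bar> = ?e / ((a + x) * (a + y))"
    using assms by (simp add: abs_mult abs_minus_commute)
  also have "\<dots> \<le> ?e / (1 + ?e)" using le assms by (intro divide_left_mono) (auto intro: mult_pos_pos)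
  also have "\<dots> \<le> \<delta> / (1 + \<delta>)" using assms by (simp add: field_simps)
  finally show ?thesis .
qed

lemma cfk_close:
  assumes "\<And>i. 1 \<le> a i" "0 \<le> x" "x \<le> 1" "0 \<le> y" "y \<le> 1"
  shows "\<bar>cfk a k x - cfk a k y\<bar> \<le> 1 / (real k + 1)"
  using assms(1)
proof (induction k arbitrary: a)
  case (Suc k)
  have "\<bar>cfk (\<lambda>i. a (Suc i)) k x - cfk (\<lambda>i. a (Suc i)) k y\<bar> \<le> 1 / (real k + 1)"
    using Suc.IH[of "\<lambda>i. a (Suc i)"] Suc.prems by simp
  moreover have "0 \<le> cfk (\<lambda>i. a (Suc i)) k x" "0 \<le> cfk (\<lambda>i. a (Suc i)) k y"
    using cfk_bounds[of "\<lambda>i. a (Suc i)" x k] cfk_bounds[of "\<lambda>i. a (Suc i)" y k] Suc.prems assms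
    by auto
  ultimately have "\<bar>cfk a (Suc k) x - cfk a (Suc k) y\<bar> \<le> (1 / (real k + 1)) / (1 + 1 / (real k + 1))"
    unfolding cfk.simps using Suc.prems[of 0] by (intro inverse_shift_contraction) auto
  also have "\<dots> = 1 / (real (Suc k) + 1)" by (simp add: field_simps)
  finally show ?case .
qed (use assms in auto)

lemma cfk_add: "cfk a (k + l) x = cfk a k (cfk (\<lambda>i. a (k + i)) l x)"
  by (induction k arbitrary: a) auto

lemma cfk_cong: "(\<And>i. i < k \<Longrightarrow> a i = b i) \<Longrightarrow> cfk a k x = cfk b k x"
proof (induction k arbitrary: a b)
  case (Suc k)
  have "cfk (\<lambda>i. a (Suc i)) k x = cfk (\<lambda>i. b (Suc i)) k x" using Suc.prems by (intro Suc.IH) auto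
  then show ?case using Suc.prems[of 0] by simp
qed auto

lemma (in cfrac) theta_cfk: "\<theta> n = cfk (\<lambda>i. d (n + i)) k (\<theta> (n + k))"
proof (induction k arbitrary: n)
  case (Suc k)
  have "\<theta> n = 1 / (real (d n) + \<theta> (Suc n))"
    using th_rec[of n] th_pos[of n] th_pos[of "Suc n"] by (simp add: field_simps)
  then show ?case using Suc[of "Suc n"] by simp
qed auto

text \<open>The mirror image of \<open>theta_cfk\<close>: digits are read leftwards from position
  \<open>n - 1\<close>.\<close>

lemma (in cfrac) R_cfk:
  assumes "k \<le> n" "\<And>j. j < k \<Longrightarrow> d (n - 1 - j) = b j"
  shows "R n = cfk b k (R (n - k))"
  using assms
proof (induction k arbitrary: n b)
  case (Suc k)
  then obtain m where n: "n = Suc m" by (cases n) auto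
  have "d (m - 1 - j) = b (Suc j)" if "j < k" for j
    using Suc.prems(2)[of "Suc j"] that n by simp
  then have "R m = cfk (\<lambda>j. b (Suc j)) k (R (m - k))"
    using Suc.prems n by (intro Suc.IH) auto
  then show ?case using Suc.prems(2)[of 0] n by (simp add: R_Suc)
qed auto

text \<open>Truncations with tail 0 are Cauchy by \<open>cfk_close\<close>, and the recursion passes
  to their limits.\<close>

lemma cfrac_exists_of_digits:
  assumes d: "\<And>n. 1 \<le> d n"
  obtains \<theta> where "cfrac d \<theta>"
proof -
  define X where "X n k = cfk (\<lambda>i. d (n + i)) k 0" for n k
  have Xb: "0 \<le> X n k" "X n k \<le> 1" for n k
    using cfk_bounds[of "\<lambda>i. d (n + i)" 0 k] d by (auto simp: X_def)
  have close: "\<bar>X n (k + l) - X n k\<bar> \<le> 1 / (real k + 1)" for n k l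
  proof -
    have "X n (k + l) = cfk (\<lambda>i. d (n + i)) k (X (n + k) l)"
      by (simp add: X_def cfk_add add.assoc)
    then show ?thesis
      using cfk_close[of "\<lambda>i. d (n + i)" "X (n + k) l" 0 k] d Xb by (simp add: X_def)
  qed
  have "Cauchy (X n)" for n
  proof (rule metric_CauchyI)
    fix e :: real assume "0 < e"
    then obtain M where M: "1 / (real M + 1) < e / 2"
      using reals_Archimedean[of "e / 2"] by (auto simp: inverse_eq_divide add.commute)
    have "dist (X n k) (X n M) < e / 2" if "M \<le> k" for k
      using close[of n M "k - M"] M that by (simp add: dist_real_def)
    then show "\<exists>M. \<forall>k\<ge>M. \<forall>l\<ge>M. dist (X n k) (X n l) < e"
      by (metis dist_triangle_half_l)
  qed
  then have conv: "X n \<longlonglongrightarrow> lim (X n)" for n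
    by (simp add: Cauchy_convergent_iff convergent_LIMSEQ_iff)
  define \<theta> where "\<theta> n = lim (X n)" for n
  have lims: "X n \<longlonglongrightarrow> \<theta> n" for n using conv by (simp add: \<theta>_def)
  have nn: "0 \<le> \<theta> n" for n using LIMSEQ_le_const[OF lims] Xb by blast
  have rec: "\<theta> n = 1 / (real (d n) + \<theta> (Suc n))" for n
  proof -
    have "X n (Suc k) = 1 / (real (d n) + X (Suc n) k)" for k by (simp add: X_def)
    moreover have "(\<lambda>k. 1 / (real (d n) + X (Suc n) k)) \<longlonglongrightarrow> 1 / (real (d n) + \<theta> (Suc n))"
      using d[of n] nn[of "Suc n"] by (intro tendsto_intros lims) auto
    ultimately have "(\<lambda>k. X n (Suc k)) \<longlonglongrightarrow> 1 / (real (d n) + \<theta> (Suc n))" by simp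
    then show ?thesis using LIMSEQ_Suc[OF lims[of n]] LIMSEQ_unique by blast
  qed
  have pos: "0 < \<theta> n" for n
    using rec[of n] nn[of "Suc n"] d[of n] by simp
  have "cfrac d \<theta>"
  proof
    fix n
    show "1 \<le> d n" "0 < \<theta> n" using d pos by auto
    have "1 < real (d n) + \<theta> (Suc n)" using d[of n] pos[of "Suc n"] by linarith
    then show "\<theta> n < 1" "\<theta> n * (real (d n) + \<theta> (Suc n)) = 1"
      unfolding rec[of n] by auto
  qed
  then show ?thesis by (rule that)
qed

section \<open>Badly approximable numbers\<close>

definition badly_approximable :: "real \<Rightarrow> real \<Rightarrow> bool" where
  "badly_approximable c x \<longleftrightarrow>
     (\<forall>p q :: int. 0 < q \<longrightarrow> c \<le> of_int q * \<bar>of_int q * x - of_int p\<bar>)"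

text \<open>Distinct fractions with these denominators differ by at least
  \<open>1 / (q * q')\<close>, which exceeds \<open>1 / K\<^sup>2\<close>.\<close>

lemma rational_spacing:
  fixes p q p' q' :: int and K :: real
  assumes "0 < q" "0 < q'" "of_int q < K" "of_int q' < K"
    and "\<bar>of_int p / of_int q - of_int p' / of_int q'\<bar> \<le> 1 / K\<^sup>2"
  shows "of_int p / of_int q = (of_int p' / of_int q' :: real)"
proof (rule ccontr)
  assume ne: "of_int p / of_int q \<noteq> (of_int p' / of_int q' :: real)"
  have q: "0 < real_of_int q" "0 < real_of_int q'" using assms by auto
  have eq: "of_int p / of_int q - of_int p' / of_int q' = (real_of_int (p * q' - p' * q)) / (of_int q * of_int q')"
    using q by (simp add: field_simps)
  have "p * q' - p' * q \<noteq> 0"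
  proof
    assume "p * q' - p' * q = 0"
    then have "of_int p / of_int q - of_int p' / of_int q' = (0 :: real)" unfolding eq by simp
    with ne show False by simp
  qed
  then have "1 \<le> \<bar>real_of_int (p * q' - p' * q)\<bar>" by linarith
  moreover have "real_of_int q * of_int q' < K * K"
    using assms q by (intro mult_strict_mono) auto
  then have "1 / K\<^sup>2 < 1 / (real_of_int q * of_int q')"
    using q assms by (intro divide_strict_left_mono) (auto simp: power2_eq_square intro!: mult_pos_pos)
  ultimately have "1 / K\<^sup>2 < \<bar>real_of_int (p * q' - p' * q)\<bar> / (of_int q * of_int q')"
    using q by (smt (verit) divide_right_mono mult_pos_pos)
  also have "\<dots> = \<bar>of_int p / of_int q - of_int p' / of_int q'\<bar>"
    unfolding eq using q by (simp add: abs_mult)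
  finally show False using assms by linarith
qed

text \<open>Two fractions within \<open>\<rho>\<close> of the interval lie within
  \<open>L + 2 * \<rho>\<close> of each other, hence coincide. So a short interval has a single
  point \<open>u\<close> to avoid.\<close>

lemma single_obstacle:
  fixes x L \<rho> K :: real
  assumes "L + 2 * \<rho> \<le> 1 / K\<^sup>2"
  obtains u :: real where "\<And>(p :: int) (q :: int) z. \<lbrakk>0 < q; of_int q < K; x \<le> z; z \<le> x + L;
      \<bar>z - of_int p / of_int q\<bar> < \<rho>\<rbrakk> \<Longrightarrow> of_int p / of_int q = u"
proof (cases "\<exists>(p :: int) (q :: int) z. 0 < q \<and> of_int q < K \<and> x \<le> z \<and> z \<le> x + L \<and>
      \<bar>z - of_int p / of_int q\<bar> < \<rho>")
  case True
  then obtain p0 q0 :: int and z0 where 0: "0 < q0" "of_int q0 < K" "x \<le> z0" "z0 \<le> x + L"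
      "\<bar>z0 - of_int p0 / of_int q0\<bar> < \<rho>" by blast
  show ?thesis
  proof (rule that[of "of_int p0 / of_int q0"])
    fix p q :: int and z :: real
    assume *: "0 < q" "of_int q < K" "x \<le> z" "z \<le> x + L" "\<bar>z - of_int p / of_int q\<bar> < \<rho>"
    have "\<bar>of_int p / of_int q - of_int p0 / of_int q0\<bar> \<le> L + 2 * \<rho>"
      using * 0 by linarith
    then show "real_of_int p / of_int q = of_int p0 / of_int q0"
      using * 0 assms by (intro rational_spacing[of _ _ K]) auto
  qed
next
  case False
  \<comment> \<open>No fraction comes near, so any value of \<open>u\<close> will do.\<close>
  then show ?thesis by (intro that[of 0]) blast
qed

text \<open>The three candidate intervals are so far apart that each of the two obstacles can spoil
  at most one of them.\<close>

lemma avoid_two_points: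
  fixes x L \<rho> u v :: real
  assumes "0 < \<rho>" "16 * \<rho> \<le> L"
  obtains y where "x \<le> y" "y + L / 4 \<le> x + L"
    "\<And>z. \<lbrakk>y \<le> z; z \<le> y + L / 4\<rbrakk> \<Longrightarrow> \<rho> \<le> \<bar>z - u\<bar> \<and> \<rho> \<le> \<bar>z - v\<bar>"
proof -
  define ok where "ok y t \<longleftrightarrow> (t + \<rho> \<le> y \<or> y + L / 4 + \<rho> \<le> t)" for y t
  \<comment> \<open>The gaps have length \<open>L / 8\<close>, at least
    \<open>2 * \<rho>\<close>.\<close>
  have "\<exists>y \<in> {x, x + 3 * L / 8, x + 3 * L / 4}. ok y u \<and> ok y v"
    unfolding ok_def using assms by (simp, argo)
  then obtain y where y: "y \<in> {x, x + 3 * L / 8, x + 3 * L / 4}" "ok y u" "ok y v" by blast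
  show ?thesis
  proof (rule that[of y])
    show "x \<le> y" "y + L / 4 \<le> x + L" using y(1) assms by auto
    fix z assume "y \<le> z" "z \<le> y + L / 4"
    then show "\<rho> \<le> \<bar>z - u\<bar> \<and> \<rho> \<le> \<bar>z - v\<bar>"
      using y(2,3) unfolding ok_def by linarith
  qed
qed

text \<open>With \<open>L = 2 / 9 / 4 ^ n\<close> and \<open>K = 2 ^ Suc n\<close>, the constants
  solve \<open>L + 2 * \<rho> = 1 / K\<^sup>2\<close> and \<open>L = 16 * \<rho>\<close>, the
  extreme cases of the two preceding lemmas.\<close>

lemma avoid_rationals_step:
  fixes x s :: real and n :: nat
  defines "\<rho> \<equiv> 1 / 72 / 4 ^ n"
  obtains y where "x \<le> y" "y + 2 / 9 / 4 ^ Suc n \<le> x + 2 / 9 / 4 ^ n"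
    "\<And>z (p :: int) (q :: int). \<lbrakk>y \<le> z; z \<le> y + 2 / 9 / 4 ^ Suc n; 0 < q; of_int q < (2::real) ^ Suc n\<rbrakk>
       \<Longrightarrow> \<rho> \<le> \<bar>z - of_int p / of_int q\<bar> \<and> \<rho> \<le> \<bar>s - z - of_int p / of_int q\<bar>"
proof -
  define L :: real where "L = 2 / 9 / 4 ^ n"
  have p4: "((2::real) ^ Suc n)\<^sup>2 = 4 * 4 ^ n"
    by (simp add: power_mult_distrib power_even_eq[symmetric] power2_eq_square flip: power_mult_distrib)
  have L: "L + 2 * \<rho> \<le> 1 / ((2::real) ^ Suc n)\<^sup>2"
    unfolding p4 by (simp add: L_def \<rho>_def field_simps)
  obtain u :: real where u: "\<And>(p :: int) (q :: int) z. \<lbrakk>0 < q; of_int q < (2::real) ^ Suc n; x \<le> z; z \<le> x + L;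
      \<bar>z - of_int p / of_int q\<bar> < \<rho>\<rbrakk> \<Longrightarrow> of_int p / of_int q = u"
    using single_obstacle[OF L, of x] by blast
  \<comment> \<open>As \<open>z\<close> runs through \<open>[x, x + L]\<close>, \<open>s - z\<close>
    runs through \<open>[s - x - L, s - x]\<close>; its obstacle \<open>v\<close> reflects to
    \<open>s - v\<close>.\<close>
  obtain v :: real where v: "\<And>(p :: int) (q :: int) z. \<lbrakk>0 < q; of_int q < (2::real) ^ Suc n;
      s - x - L \<le> z; z \<le> s - x - L + L; \<bar>z - of_int p / of_int q\<bar> < \<rho>\<rbrakk> \<Longrightarrow> of_int p / of_int q = v"
    using single_obstacle[OF L, of "s - x - L"] by blast
  have "0 < \<rho>" "16 * \<rho> \<le> L" by (auto simp: L_def \<rho>_def)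
  then obtain y where y: "x \<le> y" "y + L / 4 \<le> x + L"
    and av: "\<And>z. \<lbrakk>y \<le> z; z \<le> y + L / 4\<rbrakk> \<Longrightarrow> \<rho> \<le> \<bar>z - u\<bar> \<and> \<rho> \<le> \<bar>z - (s - v)\<bar>"
    using avoid_two_points[of \<rho> L x u "s - v"] by blast
  have L4: "2 / 9 / 4 ^ Suc n = L / 4" by (simp add: L_def)
  show ?thesis
  proof (rule that[of y])
    show "x \<le> y" "y + 2 / 9 / 4 ^ Suc n \<le> x + 2 / 9 / 4 ^ n"
      using y unfolding L4 by (auto simp: L_def)
    fix z and p q :: int
    assume *: "y \<le> z" "z \<le> y + 2 / 9 / 4 ^ Suc n" "0 < q" "of_int q < (2::real) ^ Suc n"
    then have z: "x \<le> z" "z \<le> x + L" "z \<le> y + L / 4" using y unfolding L4 by auto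
    show "\<rho> \<le> \<bar>z - of_int p / of_int q\<bar> \<and> \<rho> \<le> \<bar>s - z - of_int p / of_int q\<bar>"
    proof (rule ccontr)
      assume "\<not> ?thesis"
      then consider "\<bar>z - of_int p / of_int q\<bar> < \<rho>" | "\<bar>s - z - of_int p / of_int q\<bar> < \<rho>" by linarith
      then show False
      proof cases
        case 1
        with u[of q z p] * z av[of z] show False by auto
      next
        case 2
        with v[of q "s - z" p] * z have "of_int p / of_int q = v" by auto
        with 2 av[of z] * z show False by auto
      qed
    qed
  qed
qed

text \<open>Take \<open>\<beta>\<close> in all nested intervals. If
  \<open>2 ^ n \<le> q < 2 ^ Suc n\<close>, stage \<open>n\<close> keeps both numbers at distance at
  least \<open>1 / 72 / 4 ^ n\<close>, hence at least \<open>1 / (72 * q\<^sup>2)\<close>, from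
  fractions over \<open>q\<close>.\<close>

lemma badly_approximable_sum:
  obtains \<beta> where "badly_approximable (1/72) \<beta>" "badly_approximable (1/72) (s - \<beta>)"
proof -
  define good where "good n x y \<longleftrightarrow> x \<le> y \<and> y + 2 / 9 / 4 ^ Suc n \<le> x + 2 / 9 / 4 ^ n \<and>
    (\<forall>z (p :: int) (q :: int). y \<le> z \<longrightarrow> z \<le> y + 2 / 9 / 4 ^ Suc n \<longrightarrow> 0 < q \<longrightarrow> of_int q < (2::real) ^ Suc n \<longrightarrow>
      1 / 72 / 4 ^ n \<le> \<bar>z - of_int p / of_int q\<bar> \<and> 1 / 72 / 4 ^ n \<le> \<bar>s - z - of_int p / of_int q\<bar>)"
    for n and x y :: real
  have "\<exists>y. good n x y" for n x
    using avoid_rationals_step[of x n s] unfolding good_def by metis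
  then obtain f where f: "\<And>n x. good n x (f n x)" by metis
  define X where "X = rec_nat 0 f"
  have X: "good n (X n) (X (Suc n))" for n using f by (simp add: X_def)
  define I where "I n = {X n .. X n + 2 / 9 / 4 ^ n}" for n
  have sub: "I (Suc n) \<subseteq> I n" for n using X[of n] by (auto simp: I_def good_def)
  have "\<Inter> (range I) \<noteq> {}"
  proof (rule compact_nest)
    show "compact (I n)" "I n \<noteq> {}" for n by (auto simp: I_def)
    show "I n \<subseteq> I m" if "m \<le> n" for m n using lift_Suc_antimono_le[of I, OF sub that] .
  qed
  then obtain \<beta> where \<beta>: "\<And>n. \<beta> \<in> I n" by auto
  have "1/72 \<le> of_int q * \<bar>of_int q * \<beta> - of_int p\<bar> \<and> 1/72 \<le> of_int q * \<bar>of_int q * (s - \<beta>) - of_int p\<bar>"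
    if q: "0 < q" for p q :: int
  proof -
    have "\<exists>n. real_of_int q < 2 ^ n" using real_arch_pow[of 2 "real_of_int q"] by auto
    define m where "m = (LEAST n. real_of_int q < 2 ^ n)"
    have m: "real_of_int q < 2 ^ m" unfolding m_def by (rule LeastI_ex) fact
    with q obtain n where n: "m = Suc n" by (cases m) auto
    then have "2 ^ n \<le> real_of_int q"
      using not_less_Least[of n "\<lambda>n. real_of_int q < 2 ^ n"] unfolding m_def by force
    then have "(2 ^ n)\<^sup>2 \<le> (real_of_int q)\<^sup>2" by (intro power_mono) auto
    then have q2: "4 ^ n \<le> real_of_int q * real_of_int q"
      by (simp add: power2_eq_square flip: power_mult_distrib)
    have *: "1 / 72 / 4 ^ n \<le> \<bar>\<beta> - of_int p / of_int q\<bar>" "1 / 72 / 4 ^ n \<le> \<bar>s - \<beta> - of_int p / of_int q\<bar>"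
      using X[of n] \<beta>[of "Suc n"] m q unfolding good_def I_def n by auto
    have scale: "1/72 \<le> of_int q * \<bar>of_int q * w - of_int p\<bar>" if "1 / 72 / 4 ^ n \<le> \<bar>w - of_int p / of_int q\<bar>" for w :: real
    proof -
      have "1/72 = 4 ^ n * (1 / 72 / 4 ^ n :: real)" by simp
      also have "\<dots> \<le> (of_int q * of_int q) * \<bar>w - of_int p / of_int q\<bar>"
        using q2 that by (intro mult_mono) auto
      also have "\<dots> = of_int q * \<bar>of_int q * (w - of_int p / of_int q)\<bar>"
        using q by (simp add: abs_mult)
      also have "\<dots> = of_int q * \<bar>of_int q * w - of_int p\<bar>"
        using q by (simp add: right_diff_distrib)
      finally show ?thesis .
    qed
    show ?thesis using scale[OF *(1)] scale[OF *(2)] by simp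
  qed
  then show ?thesis using that[of \<beta>] unfolding badly_approximable_def by blast
qed

section \<open>Prescribing Lagrange values\<close>

text \<open>The lower limit of \<open>b * |b * t - a|\<close>, as two one-sided conditions.
  Coprimality in the second makes \<open>b\<close> the height of the associated rational
  point.\<close>

definition has_lagrange_value :: "real \<Rightarrow> real \<Rightarrow> bool" where
  "has_lagrange_value t \<mu> \<longleftrightarrow>
     (\<forall>\<nu><\<mu>. \<exists>B. \<forall>a b :: int. 0 < b \<longrightarrow> B \<le> b \<longrightarrow> \<nu> \<le> of_int b * \<bar>of_int b * t - of_int a\<bar>) \<and>
     (\<forall>\<nu>>\<mu>. \<forall>B. \<exists>a b :: int. 0 < b \<and> B \<le> b \<and> coprime a b \<and> of_int b * \<bar>of_int b * t - of_int a\<bar> \<le> \<nu>)"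

text \<open>Around each position \<open>r\<^sup>2\<close>, carrying the digit \<open>A r\<close>, the digits of \<open>a\<close> are
  written to the right and those of \<open>b\<close> to the left, about \<open>r\<close> of each.\<close>

definition spliced_digits :: "(nat \<Rightarrow> nat) \<Rightarrow> (nat \<Rightarrow> nat) \<Rightarrow> (nat \<Rightarrow> nat) \<Rightarrow> nat \<Rightarrow> nat" where
  "spliced_digits A a b m =
     (let r = floor_sqrt m; e = m - r\<^sup>2 in if e = 0 then A r else if e \<le> r then a (e - 1) else b (2 * r - e))"

text \<open>Offsets up to \<open>2 * r\<close> are those that stay below
  \<open>(r + 1)\<^sup>2\<close>. The first \<open>r\<close> nonzero ones read \<open>a\<close>
  forwards, the rest read \<open>b\<close> backwards, ending with \<open>b 0\<close> next to the
  following square.\<close>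

lemma spliced_digits_offset:
  assumes "e \<le> 2 * r"
  shows "spliced_digits A a b (r\<^sup>2 + e) = (if e = 0 then A r else if e \<le> r then a (e - 1) else b (2 * r - e))"
proof -
  have "floor_sqrt (r\<^sup>2 + e) = r"
    using assms by (intro floor_sqrt_unique) (auto simp: power2_eq_square)
  then show ?thesis by (simp add: spliced_digits_def)
qed

lemma spliced_digits_centre: "spliced_digits A a b (r\<^sup>2) = A r"
  using spliced_digits_offset[of 0 r] by simp

lemma spliced_digits_right: "j < r \<Longrightarrow> spliced_digits A a b (Suc (r\<^sup>2) + j) = a j"
  using spliced_digits_offset[of "Suc j" r] by simp

lemma spliced_digits_left:
  assumes "j < r"
  shows "spliced_digits A a b ((Suc r)\<^sup>2 - 1 - j) = b j"
proof -
  have "(Suc r)\<^sup>2 - 1 - j = r\<^sup>2 + (2 * r - j)" using assms by (simp add: power2_eq_square)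
  moreover have "2 * r - j \<noteq> 0" "\<not> 2 * r - j \<le> r" "2 * r - (2 * r - j) = j" using assms by auto
  ultimately show ?thesis using spliced_digits_offset[of "2 * r - j" r A a b] by simp
qed

lemma spliced_digits_other:
  obtains r where "m = r\<^sup>2" | j where "spliced_digits A a b m = a j" | j where "spliced_digits A a b m = b j"
proof -
  define r where "r = floor_sqrt m"
  have "r\<^sup>2 \<le> m" by (simp add: r_def)
  then show ?thesis
    using that(1)[of r] that(2,3) unfolding spliced_digits_def r_def[symmetric] Let_def
    by (cases "m - r\<^sup>2 = 0"; cases "m - r\<^sup>2 \<le> r") auto
qed

section \<open>From digit sequences to Lagrange values\<close>

lemma inverse_close:
  fixes x y :: real
  assumes "1 \<le> x" "1 \<le> y"
  shows "\<bar>1 / x - 1 / y\<bar> \<le> \<bar>x - y\<bar>"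
proof -
  have "1 \<le> x * y" using assms mult_mono[of 1 x 1 y] by simp
  have "1 / x - 1 / y = (y - x) / (x * y)" using assms by (simp add: field_simps)
  then have "\<bar>1 / x - 1 / y\<bar> = \<bar>x - y\<bar> / (x * y)" using assms by (simp add: abs_mult abs_minus_commute)
  also have "\<dots> \<le> \<bar>x - y\<bar> / 1" using \<open>1 \<le> x * y\<close> by (intro divide_left_mono) auto
  finally show ?thesis by simp
qed

text \<open>Along the squares the tails on both sides converge to \<open>\<alpha> 0\<close> and
  \<open>\<beta> 0\<close>, which gives the limit \<open>\<mu>\<close>. Elsewhere the digit is at
  most \<open>N\<close> and both tails at most 1, so the value is at least
  \<open>1 / (N + 2)\<close>. Letting \<open>A\<close> vary admits \<open>\<mu> = 0\<close>.\<close>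

lemma lagrange_value_of_digits:
  assumes a: "cfrac a \<alpha>" and b: "cfrac b \<beta>"
    and aN: "\<And>n. a n \<le> N" and bN: "\<And>n. b n \<le> N" and A: "\<And>r. 1 \<le> A r"
    and lim: "(\<lambda>r. 1 / (real (A r) + \<alpha> 0 + \<beta> 0)) \<longlonglongrightarrow> \<mu>" and \<mu>: "\<mu> \<le> 1 / (real N + 2)"
  obtains t where "t \<notin> \<rat>" "has_lagrange_value t \<mu>"
proof -
  interpret a: cfrac a \<alpha> by fact
  interpret b: cfrac b \<beta> by fact
  define d where "d = spliced_digits A a b"
  have d1: "1 \<le> d n" for n
    unfolding d_def using A a.d_pos b.d_pos
    by (cases n rule: spliced_digits_other[where A = A and a = a and b = b]) (auto simp: spliced_digits_centre)
  obtain \<theta> where "cfrac d \<theta>" using cfrac_exists_of_digits d1 by blast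
  then interpret cfrac d \<theta> .
  define S where "S n = real (d n) + \<theta> (Suc n) + R n" for n
  have S1: "1 \<le> S n" for n
    using d_pos[of n] th_pos[of "Suc n"] R_nonneg[of n] by (simp add: S_def)
  have near: "\<bar>1 / S ((Suc r)\<^sup>2) - 1 / (real (A (Suc r)) + \<alpha> 0 + \<beta> 0)\<bar> \<le> 2 / (real r + 1)" for r
  proof -
    \<comment> \<open>The block of \<open>b\<close> before this square has only \<open>r\<close>
      digits, so \<open>r\<close> digits are compared on both sides.\<close>
    let ?n = "(Suc r)\<^sup>2"
    have "\<theta> (Suc ?n) = cfk a r (\<theta> (Suc ?n + r))"
      by (subst theta_cfk[of _ r]) (rule cfk_cong, simp only: d_def, rule spliced_digits_right, simp)
    moreover have "\<alpha> 0 = cfk a r (\<alpha> r)" using a.theta_cfk[of 0 r] by simp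
    ultimately have 1: "\<bar>\<theta> (Suc ?n) - \<alpha> 0\<bar> \<le> 1 / (real r + 1)"
      using cfk_close[of a "\<theta> (Suc ?n + r)" "\<alpha> r" r] a.d_pos th_pos th_less a.th_pos a.th_less
      by (simp add: less_imp_le)
    have "R ?n = cfk b r (R (?n - r))"
      by (rule R_cfk) (auto simp only: d_def spliced_digits_left, simp add: power2_eq_square)
    moreover have "\<beta> 0 = cfk b r (\<beta> r)" using b.theta_cfk[of 0 r] by simp
    ultimately have 2: "\<bar>R ?n - \<beta> 0\<bar> \<le> 1 / (real r + 1)"
      using cfk_close[of b "R (?n - r)" "\<beta> r" r] b.d_pos R_nonneg R_le b.th_pos b.th_less
      by (simp add: less_imp_le)
    have dA: "d ?n = A (Suc r)" unfolding d_def by (rule spliced_digits_centre)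
    have "\<bar>1 / S ?n - 1 / (real (A (Suc r)) + \<alpha> 0 + \<beta> 0)\<bar> \<le> \<bar>S ?n - (real (A (Suc r)) + \<alpha> 0 + \<beta> 0)\<bar>"
      using S1 A[of "Suc r"] a.th_pos[of 0] b.th_pos[of 0] by (intro inverse_close) auto
    also have "\<dots> \<le> 1 / (real r + 1) + 1 / (real r + 1)" using 1 2 unfolding S_def dA by linarith
    finally show ?thesis by simp
  qed
  have limS: "(\<lambda>r. 1 / S (r\<^sup>2)) \<longlonglongrightarrow> \<mu>"
  proof (rule LIMSEQ_imp_Suc)
    have "(\<lambda>r. 2 / (real r + 1)) \<longlonglongrightarrow> 0"
      using tendsto_mult_right_zero[OF LIMSEQ_inverse_real_of_nat, of 2]
      by (simp add: field_simps)
    then have "(\<lambda>r. 1 / S ((Suc r)\<^sup>2) - 1 / (real (A (Suc r)) + \<alpha> 0 + \<beta> 0)) \<longlonglongrightarrow> 0"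
      by (rule Lim_null_comparison[rotated]) (use near in auto)
    from tendsto_add[OF this LIMSEQ_Suc[OF lim]] show "(\<lambda>r. 1 / S ((Suc r)\<^sup>2)) \<longlonglongrightarrow> \<mu>" by simp
  qed
  have "has_lagrange_value (\<theta> 0) \<mu>"
    unfolding has_lagrange_value_def
  proof (intro conjI allI impI)
    fix \<nu> assume \<nu>: "\<nu> < \<mu>"
    obtain r0 where r0: "\<And>r. r0 \<le> r \<Longrightarrow> \<nu> < 1 / S (r\<^sup>2)"
      using order_tendstoD(1)[OF limS \<nu>] by (auto simp: eventually_sequentially)
    have low: "\<nu> \<le> 1 / S n" if "r0\<^sup>2 \<le> n" for n
    proof -
      have small: "\<nu> \<le> 1 / S n" if "d n \<le> N"
      proof -
        have "S n \<le> real N + 2" using that th_less[of "Suc n"] R_le[of n] by (simp add: S_def)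
        then have "1 / (real N + 2) \<le> 1 / S n" using S1[of n] by (intro divide_left_mono) auto
        then show ?thesis using \<mu> \<nu> by linarith
      qed
      show ?thesis
      proof (cases n rule: spliced_digits_other[where A = A and a = a and b = b])
        case (1 r)
        then have "r0 \<le> r" using that by (simp add: power2_nat_le_eq_le)
        then show ?thesis using r0 1 by (simp add: less_imp_le)
      next
        case 2
        then show ?thesis using small aN by (simp add: d_def)
      next
        case 3
        then show ?thesis using small bN by (simp add: d_def)
      qed
    qed
    show "\<exists>B. \<forall>a b. 0 < b \<longrightarrow> B \<le> b \<longrightarrow> \<nu> \<le> of_int b * \<bar>of_int b * \<theta> 0 - of_int a\<bar>"
      using approximation_lower_bound[of "r0\<^sup>2", OF _ low[unfolded S_def]] by blast
  next
    fix \<nu> and B :: int assume \<nu>: "\<mu> < \<nu>"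
    obtain r0 where r0: "\<And>r. r0 \<le> r \<Longrightarrow> 1 / S (r\<^sup>2) < \<nu>"
      using order_tendstoD(2)[OF limS \<nu>] by (auto simp: eventually_sequentially)
    define r where "r = max r0 (nat B)"
    have "B \<le> int r" by (simp add: r_def)
    also have "\<dots> \<le> int (r\<^sup>2)" by (simp only: of_nat_le_iff power2_eq_square le_square)
    also have "\<dots> \<le> Q (Suc (r\<^sup>2))" by (rule Q_ge)
    finally have "B \<le> Q (Suc (r\<^sup>2))" .
    moreover have "of_int (Q (Suc (r\<^sup>2))) * \<bar>of_int (Q (Suc (r\<^sup>2))) * \<theta> 0 - of_int (P (Suc (r\<^sup>2)))\<bar> \<le> \<nu>"
      using r0[of r] Q_times_E[of "r\<^sup>2"] by (simp add: E_def S_def r_def)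
    ultimately show "\<exists>a b. 0 < b \<and> B \<le> b \<and> coprime a b \<and> of_int b * \<bar>of_int b * \<theta> 0 - of_int a\<bar> \<le> \<nu>"
      using coprime_P_Q Q_Suc_pos by blast
  qed
  then show ?thesis using that irrational by blast
qed

text \<open>Testing the inequality on convergents bounds \<open>d n + \<theta> (Suc n) + R n\<close>
  by 72; passing to \<open>frac x\<close> only shifts the numerators.\<close>

lemma badly_approximable_cfrac:
  assumes "badly_approximable (1/72) x"
  obtains d \<theta> where "cfrac d \<theta>" "\<theta> 0 = frac x" "\<And>n. d n \<le> 72"
proof -
  have bad: "1/72 \<le> of_int q * \<bar>of_int q * frac x - of_int p\<bar>" if "0 < q" for p q :: int
  proof -
    have "of_int q * frac x - of_int p = of_int q * x - of_int (p + q * \<lfloor>x\<rfloor>)"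
      by (simp add: frac_def algebra_simps)
    then show ?thesis using assms that unfolding badly_approximable_def by metis
  qed
  have "frac x \<notin> \<rat>"
  proof
    assume "frac x \<in> \<rat>"
    then obtain p q :: int where "0 < q" "frac x = of_int p / of_int q" by (metis Rats_cases')
    with bad[of q p] show False by simp
  qed
  then have "frac x \<noteq> 0" using Rats_0 by metis
  then have "0 < frac x" using frac_ge_0[of x] by linarith
  then obtain d \<theta> where d: "cfrac d \<theta>" "\<theta> 0 = frac x"
    using cfrac_exists_of_irrational \<open>frac x \<notin> \<rat>\<close> frac_lt_1 by blast
  interpret cfrac d \<theta> by fact
  have "d n \<le> 72" for n
  proof -
    have "1/72 \<le> 1 / (real (d n) + \<theta> (Suc n) + R n)"
      using bad[OF Q_Suc_pos, of n "P (Suc n)"] Q_times_E[of n] by (simp add: E_def d(2))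
    moreover have "0 < real (d n) + \<theta> (Suc n) + R n"
      using d_pos[of n] th_pos[of "Suc n"] R_nonneg[of n] by simp
    ultimately have "real (d n) + \<theta> (Suc n) + R n \<le> 72" by (simp add: field_simps)
    then have "real (d n) \<le> 72" using th_pos[of "Suc n"] R_nonneg[of n] by linarith
    then show ?thesis by simp
  qed
  then show ?thesis using that d by blast
qed

text \<open>The bound is \<open>1 / (72 + 2)\<close>, from digits at most 72.\<close>

lemma exists_lagrange_value:
  assumes "0 \<le> \<mu>" "\<mu> \<le> 1 / 74"
  obtains t where "t \<notin> \<rat>" "has_lagrange_value t \<mu>"
proof -
  define \<kappa> where "\<kappa> = 1 / \<mu>"
  obtain \<beta> where \<beta>: "badly_approximable (1/72) \<beta>" "badly_approximable (1/72) (\<kappa> - \<beta>)"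
    using badly_approximable_sum .
  obtain a x where a: "cfrac a x" "x 0 = frac (\<kappa> - \<beta>)" "\<And>n. a n \<le> 72"
    using badly_approximable_cfrac[OF \<beta>(2)] by blast
  obtain b y where b: "cfrac b y" "y 0 = frac \<beta>" "\<And>n. b n \<le> 72"
    using badly_approximable_cfrac[OF \<beta>(1)] by blast
  have "\<exists>A. (\<forall>r. 1 \<le> A r) \<and> (\<lambda>r. 1 / (real (A r) + x 0 + y 0)) \<longlonglongrightarrow> \<mu>"
  proof (cases "\<mu> = 0")
    \<comment> \<open>Here \<open>\<kappa>\<close> is \<open>1 / 0 = 0\<close> and carries no
      information; unbounded central digits force the limit 0.\<close>
    case True
    have "(\<lambda>r. 1 / (real (Suc r) + x 0 + y 0)) \<longlonglongrightarrow> 0"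
    proof (rule Lim_null_comparison[OF _ LIMSEQ_inverse_real_of_nat], intro always_eventually allI)
      fix r
      have "0 \<le> x 0" "0 \<le> y 0" using a(2) b(2) by auto
      then show "norm (1 / (real (Suc r) + x 0 + y 0)) \<le> inverse (real (Suc r))"
        by (simp add: inverse_eq_divide frac_le)
    qed
    then show ?thesis using True by (intro exI[of _ Suc]) simp
  next
    case False
    define A where "A = nat (\<lfloor>\<kappa> - \<beta>\<rfloor> + \<lfloor>\<beta>\<rfloor>)"
    have "74 \<le> \<kappa>" using False assms by (simp add: \<kappa>_def field_simps)
    \<comment> \<open>The two floors lose less than 2 in total from \<open>\<kappa>\<close>.\<close>
    then have "1 \<le> \<lfloor>\<kappa> - \<beta>\<rfloor> + \<lfloor>\<beta>\<rfloor>" by linarith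
    then have A: "1 \<le> A" "real A = of_int (\<lfloor>\<kappa> - \<beta>\<rfloor> + \<lfloor>\<beta>\<rfloor>)" by (auto simp: A_def)
    have "real A + x 0 + y 0 = \<kappa>" by (simp add: A(2) a(2) b(2) frac_def)
    then have "1 / (real A + x 0 + y 0) = \<mu>" using False by (simp add: \<kappa>_def)
    then show ?thesis using A by (intro exI[of _ "\<lambda>_. A"]) simp
  qed
  then obtain A where "\<And>r. 1 \<le> A r" "(\<lambda>r. 1 / (real (A r) + x 0 + y 0)) \<longlonglongrightarrow> \<mu>" by blast
  then show ?thesis
    using lagrange_value_of_digits[OF a(1) b(1) a(3) b(3)] assms that by auto
qed

section \<open>Heights of Gaussian rational points\<close>

lemma gauss_int_add: "gauss_int a \<Longrightarrow> gauss_int b \<Longrightarrow> gauss_int (a + b)"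
  and gauss_int_diff: "gauss_int a \<Longrightarrow> gauss_int b \<Longrightarrow> gauss_int (a - b)"
  and gauss_int_mult: "gauss_int a \<Longrightarrow> gauss_int b \<Longrightarrow> gauss_int (a * b)"
  and gauss_int_cnj: "gauss_int a \<Longrightarrow> gauss_int (cnj a)"
  and gauss_int_of_int: "gauss_int (of_int k)"
  by (auto simp: gauss_int_def)

text \<open>Squared norms become a measure with natural values, for choosing minimal
  denominators.\<close>

lemma gauss_int_norm:
  assumes "gauss_int z"
  shows "(cmod z)\<^sup>2 = real (nat \<lfloor>(cmod z)\<^sup>2\<rfloor>)"
proof -
  have "(cmod z)\<^sup>2 \<in> \<int>" using assms by (auto simp: gauss_int_def cmod_power2)
  then obtain k where k: "(cmod z)\<^sup>2 = of_int k" by (auto elim: Ints_cases)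
  moreover have "0 \<le> k" using k by (metis of_int_0_le_iff zero_le_power2)
  ultimately show ?thesis by simp
qed

lemma gauss_int_norm_ge_1:
  assumes "gauss_int z" "z \<noteq> 0"
  shows "1 \<le> cmod z"
proof -
  obtain n where n: "(cmod z)\<^sup>2 = real n" using gauss_int_norm[OF assms(1)] by blast
  moreover have "0 < (cmod z)\<^sup>2" using assms by simp
  ultimately have "1 \<le> (cmod z)\<^sup>2" by simp
  then show ?thesis by (simp add: power2_nonneg_ge_1_iff)
qed

lemma gdvd_1_norm:
  assumes "gauss_int k" "gdvd k 1"
  shows "cmod k = 1"
proof -
  obtain m where m: "gauss_int m" "1 = k * m" using assms by (auto simp: gdvd_def)
  then have "k \<noteq> 0" "m \<noteq> 0" by auto
  then have ge: "1 \<le> cmod k" "1 \<le> cmod m" using m assms gauss_int_norm_ge_1 by auto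
  have "cmod k * cmod m = 1" using m(2) by (metis norm_mult norm_one)
  moreover have "cmod k * 1 \<le> cmod k * cmod m" using ge by (intro mult_left_mono) auto
  ultimately show ?thesis using ge by simp
qed

text \<open>Rounding both coordinates of \<open>a / b\<close> leaves an error of squared norm at
  most \<open>1 / 2\<close>.\<close>

lemma gauss_int_division:
  assumes "b \<noteq> 0"
  obtains k where "gauss_int k" "cmod (a - b * k) < cmod b"
proof -
  define k where "k = Complex (of_int (round (Re (a / b)))) (of_int (round (Im (a / b))))"
  have "\<bar>Re (a / b - k)\<bar> \<le> 1/2" "\<bar>Im (a / b - k)\<bar> \<le> 1/2"
    using of_int_round_abs_le[of "Re (a / b)"] of_int_round_abs_le[of "Im (a / b)"]
    by (auto simp: k_def abs_minus_commute)
  then have "(Re (a / b - k))\<^sup>2 \<le> (1/2)\<^sup>2" "(Im (a / b - k))\<^sup>2 \<le> (1/2)\<^sup>2"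
    by (metis abs_le_square_iff abs_of_nonneg zero_le_divide_1_iff zero_le_numeral)+
  then have "(cmod (a / b - k))\<^sup>2 < 1\<^sup>2" unfolding cmod_power2 by (simp add: power2_eq_square)
  then have lt: "cmod (a / b - k) < 1" by (rule power2_less_imp_less) simp
  have "a - b * k = b * (a / b - k)" using assms by (simp add: field_simps)
  then have "cmod (a - b * k) = cmod b * cmod (a / b - k)" by (simp add: norm_mult)
  also have "\<dots> < cmod b * 1" using lt assms by (intro mult_strict_left_mono) auto
  finally show ?thesis using that[of k] by (simp add: k_def gauss_int_def)
qed

section \<open>Reduced denominators and the height\<close>

lemma gauss_rat_common_denominator:
  assumes "gauss_rat z" "gauss_rat w"
  obtains q where "gauss_int q" "q \<noteq> 0" "gauss_int (q * z)" "gauss_int (q * w)"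
proof -
  have "\<exists>n::int. n \<noteq> 0 \<and> of_int n * x \<in> \<int>" if x: "x \<in> \<rat>" for x :: real
  proof -
    obtain a b :: int where "0 < b" "x = of_int a / of_int b"
      using x by (elim Rats_cases') blast
    then have "b \<noteq> 0" "of_int b * x = of_int a" by auto
    then show ?thesis by (metis Ints_of_int)
  qed
  then obtain n1 n2 n3 n4 :: int where n: "n1 \<noteq> 0" "n2 \<noteq> 0" "n3 \<noteq> 0" "n4 \<noteq> 0"
    "of_int n1 * Re z \<in> \<int>" "of_int n2 * Im z \<in> \<int>" "of_int n3 * Re w \<in> \<int>" "of_int n4 * Im w \<in> \<int>"
    using assms unfolding gauss_rat_def by metis
  define N where "N = n1 * n2 * n3 * n4"
  have "of_int N * Re z = of_int (n2 * n3 * n4) * (of_int n1 * Re z)"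
    "of_int N * Im z = of_int (n1 * n3 * n4) * (of_int n2 * Im z)"
    "of_int N * Re w = of_int (n1 * n2 * n4) * (of_int n3 * Re w)"
    "of_int N * Im w = of_int (n1 * n2 * n3) * (of_int n4 * Im w)"
    by (auto simp: N_def)
  then have "of_int N * Re z \<in> \<int>" "of_int N * Im z \<in> \<int>" "of_int N * Re w \<in> \<int>" "of_int N * Im w \<in> \<int>"
    using n by (metis Ints_mult Ints_of_int)+
  then show ?thesis
    using n by (intro that[of "of_int N"]) (auto simp: gauss_int_def N_def)
qed

text \<open>The common denominators of \<open>z\<close> and \<open>w\<close> form an ideal of the Euclidean ring
  \<open>\<int>[i]\<close>; its generator is the denominator of the reduced representation.\<close>

lemma reduced_representation:
  assumes "gauss_rat z" "gauss_rat w"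
  obtains q where "gauss_int q" "q \<noteq> 0" "gauss_int (q * z)" "gauss_int (q * w)"
    "gcoprime3 (q * z) (q * w) q"
    "\<And>q'. \<lbrakk>gauss_int q'; q' \<noteq> 0; gauss_int (q' * z); gauss_int (q' * w); gcoprime3 (q' * z) (q' * w) q'\<rbrakk>
       \<Longrightarrow> cmod q' = cmod q"
proof -
  define D where "D q \<longleftrightarrow> gauss_int q \<and> gauss_int (q * z) \<and> gauss_int (q * w)" for q
  obtain q1 where "D q1 \<and> q1 \<noteq> 0"
    using gauss_rat_common_denominator[OF assms] unfolding D_def by blast
  from ex_has_least_nat[of "\<lambda>q. D q \<and> q \<noteq> 0", OF this, of "\<lambda>q. nat \<lfloor>(cmod q)\<^sup>2\<rfloor>"]
  obtain q where q: "D q" "q \<noteq> 0"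
    and least: "\<And>y. D y \<Longrightarrow> y \<noteq> 0 \<Longrightarrow> nat \<lfloor>(cmod q)\<^sup>2\<rfloor> \<le> nat \<lfloor>(cmod y)\<^sup>2\<rfloor>" by blast
  have min: "cmod q \<le> cmod y" if "D y" "y \<noteq> 0" for y
  proof -
    have "(cmod q)\<^sup>2 \<le> (cmod y)\<^sup>2"
      using gauss_int_norm[of q] gauss_int_norm[of y] least[OF that] that q unfolding D_def
      by (metis of_nat_mono)
    then show ?thesis by (rule power2_le_imp_le) simp
  qed
  have gen: "\<exists>k. gauss_int k \<and> y = q * k" if "D y" for y
  proof -
    obtain k where k: "gauss_int k" "cmod (y - q * k) < cmod q"
      using gauss_int_division[OF q(2)] by blast
    have "(y - q * k) * z = y * z - k * (q * z)" "(y - q * k) * w = y * w - k * (q * w)"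
      by (auto simp: algebra_simps)
    \<comment> \<open>The remainder is again a common denominator, smaller than the minimal
      \<open>q\<close>, hence zero.\<close>
    then have "D (y - q * k)"
      using that q k unfolding D_def by (auto intro!: gauss_int_diff gauss_int_mult)
    then have "y - q * k = 0" using min k(2) by (metis not_less)
    then show ?thesis using k by auto
  qed
  have cop: "gcoprime3 (q * z) (q * w) q"
    unfolding gcoprime3_def
  proof (intro allI impI)
    fix e assume e: "gauss_int e \<and> gdvd e (q * z) \<and> gdvd e (q * w) \<and> gdvd e q"
    then obtain k k1 k2 where k: "gauss_int k" "q = e * k" "gauss_int k1" "q * z = e * k1"
        "gauss_int k2" "q * w = e * k2" unfolding gdvd_def by blast
    have ne: "e \<noteq> 0" "k \<noteq> 0" using q k by auto
    \<comment> \<open>Cancelling \<open>e\<close> gives a common denominator \<open>k\<close>, so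
      minimality of \<open>q\<close> forces \<open>e\<close> to be a unit.\<close>
    have "k * z = k1" "k * w = k2" using k ne by (auto simp: mult.assoc)
    then have "cmod q \<le> cmod k" using k ne by (intro min) (auto simp: D_def)
    then have "cmod e \<le> 1" using k(2) ne by (simp add: norm_mult)
    then have "cmod e = 1" using gauss_int_norm_ge_1[of e] e ne by simp
    then have "1 = e * cnj e" by (metis complex_norm_square of_real_1 power_one)
    then show "gdvd e 1" using e gauss_int_cnj unfolding gdvd_def by blast
  qed
  have "cmod y = cmod q"
    if y: "gauss_int y" "y \<noteq> 0" "gauss_int (y * z)" "gauss_int (y * w)" "gcoprime3 (y * z) (y * w) y" for y
  proof -
    obtain k where k: "gauss_int k" "y = q * k" using gen[of y] y unfolding D_def by blast
    have "gdvd k (y * z)" "gdvd k (y * w)" "gdvd k y"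
      using q(1) unfolding gdvd_def D_def k(2) by (metis mult.assoc mult.commute)+
    then have "gdvd k 1" using y(5) k(1) unfolding gcoprime3_def by blast
    then show ?thesis using gdvd_1_norm k by (simp add: norm_mult)
  qed
  then show ?thesis using that[of q] q cop unfolding D_def by blast
qed

text \<open>\<open>height\<close> is a definite description, so it needs the uniqueness of
  \<open>cmod q\<close> from \<open>reduced_representation\<close>.\<close>

lemma height_eq:
  assumes "gauss_rat z" "gauss_rat w" "gauss_int q" "q \<noteq> 0" "gauss_int (q * z)" "gauss_int (q * w)"
    and "gcoprime3 (q * z) (q * w) q"
  shows "height (z, w) = cmod q"
proof -
  obtain q0 where uniq: "\<And>q'. \<lbrakk>gauss_int q'; q' \<noteq> 0; gauss_int (q' * z); gauss_int (q' * w);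
      gcoprime3 (q' * z) (q' * w) q'\<rbrakk> \<Longrightarrow> cmod q' = cmod q0"
    using reduced_representation[OF assms(1,2)] by metis
  show ?thesis
    unfolding height_def
  proof (rule the_equality)
    show "\<exists>p p' q'. gauss_int p \<and> gauss_int p' \<and> gauss_int q' \<and> q' \<noteq> 0 \<and> gcoprime3 p p' q' \<and>
        (z, w) = (p / q', p' / q') \<and> cmod q = cmod q'"
      using assms by (intro exI[of _ "q * z"] exI[of _ "q * w"] exI[of _ q]) auto
    fix h assume "\<exists>p p' q'. gauss_int p \<and> gauss_int p' \<and> gauss_int q' \<and> q' \<noteq> 0 \<and> gcoprime3 p p' q' \<and>
        (z, w) = (p / q', p' / q') \<and> h = cmod q'"
    then obtain p p' q' where h: "gauss_int p" "gauss_int p'" "gauss_int q'" "q' \<noteq> 0" "gcoprime3 p p' q'"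
      "z = p / q'" "w = p' / q'" "h = cmod q'" by auto
    then have "p = q' * z" "p' = q' * w" by auto
    then have "h = cmod q0" using h uniq[of q'] by simp
    then show "h = cmod q" using uniq[of q] assms by simp
  qed
qed

section \<open>The vertical chain\<close>

text \<open>On the chain the group law is addition in the first coordinate, so the distance is
  \<open>sqrt (2 * |t - a / b|)\<close>.\<close>

lemma chain_point:
  fixes a b :: int
  assumes "0 < b" "coprime a b"
  defines "r \<equiv> (Complex 0 (of_int a / of_int b), 0)"
  shows "r \<in> QQ" "height r = of_int b"
    "height r * dcyg (Complex 0 t, 0) r = sqrt (2 * (of_int b * \<bar>of_int b * t - of_int a\<bar>))"
proof -
  let ?z = "Complex 0 (of_int a / of_int b)"
  have rat: "gauss_rat ?z" "gauss_rat 0" by (auto simp: gauss_rat_def)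
  then show "r \<in> QQ" by (auto simp: r_def QQ_def QR_def)
  have qz: "of_int b * ?z = Complex 0 (of_int a)" using assms by (simp add: complex_eq_iff)
  have "gcoprime3 (Complex 0 (of_int a)) 0 (of_int b)"
    unfolding gcoprime3_def
  proof (intro allI impI)
    fix e assume "gauss_int e \<and> gdvd e (Complex 0 (of_int a)) \<and> gdvd e 0 \<and> gdvd e (of_int b)"
    then obtain k l where kl: "gauss_int k" "Complex 0 (of_int a) = e * k" "gauss_int l" "of_int b = e * l"
      unfolding gdvd_def by blast
    obtain u v where uv: "u * a + v * b = 1"
      using assms(2) bezout_int[of a b] by (auto simp: coprime_iff_gcd_eq_1)
    \<comment> \<open>The integer Bezout identity, with the factor \<open>-\<i>\<close> undoing the
      \<open>\<i>\<close> of the numerator.\<close>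
    have "Complex 0 (- of_int u) * Complex 0 (of_int a) + of_int v * of_int b = 1"
      using uv by (simp add: complex_eq_iff flip: of_int_mult of_int_add)
    then have "1 = e * (Complex 0 (- of_int u) * k + of_int v * l)"
      unfolding kl by (simp add: algebra_simps)
    moreover have "gauss_int (Complex 0 (- of_int u) * k + of_int v * l)"
      using kl by (intro gauss_int_add gauss_int_mult gauss_int_of_int) (auto simp: gauss_int_def)
    ultimately show "gdvd e 1" unfolding gdvd_def by blast
  qed
  then have "height r = cmod (of_int b)"
    unfolding r_def using assms rat
    by (intro height_eq) (auto simp: qz gauss_int_of_int gauss_int_def)
  then show h: "height r = of_int b" using assms by simp
  have "dcyg (Complex 0 t, 0) r = sqrt (2 * \<bar>t - of_int a / of_int b\<bar>)"
    by (simp add: dcyg_def cyg_gauge_def qmult_def qinv_def r_def cmod_def)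
  moreover have "(of_int b)\<^sup>2 * (2 * \<bar>t - of_int a / of_int b\<bar>) = 2 * (of_int b * \<bar>of_int b * t - of_int a\<bar>)"
  proof -
    have "\<bar>of_int b * t - of_int a\<bar> = \<bar>of_int b * (t - of_int a / of_int b)\<bar>"
      using assms by (simp add: right_diff_distrib)
    also have "\<dots> = of_int b * \<bar>t - of_int a / of_int b\<bar>" using assms by (simp add: abs_mult)
    finally show ?thesis by (simp add: power2_eq_square)
  qed
  ultimately show "height r * dcyg (Complex 0 t, 0) r = sqrt (2 * (of_int b * \<bar>of_int b * t - of_int a\<bar>))"
    unfolding h using assms by (metis abs_of_pos of_int_0_less_iff real_sqrt_abs real_sqrt_mult)
qed

text \<open>A rational point off the chain is at distance at least \<open>\<surd>2 / h\<close> from the chain, because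
  its second coordinate is a nonzero fraction with denominator \<open>q\<close>.\<close>

lemma off_chain_point:
  assumes "(z, w) \<in> QQ" "w \<noteq> 0"
  shows "sqrt 2 \<le> height (z, w) * dcyg (Complex 0 t, 0) (z, w)"
proof -
  have rat: "gauss_rat z" "gauss_rat w" and re: "2 * Re z = (cmod w)\<^sup>2"
    using assms by (auto simp: QQ_def QR_def)
  obtain q where q: "gauss_int q" "q \<noteq> 0" "gauss_int (q * z)" "gauss_int (q * w)" "gcoprime3 (q * z) (q * w) q"
    using reduced_representation[OF rat] by metis
  have h: "height (z, w) = cmod q" using height_eq rat q by blast
  let ?f = "(cmod w)\<^sup>2 - z + Complex 0 t"
  \<comment> \<open>By the equation of \<open>QR\<close>; the squared distance is thus at least
    twice \<open>(cmod w)\<^sup>2\<close>.\<close>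
  have "Re ?f = (cmod w)\<^sup>2 / 2" using re by simp
  then have "(cmod w)\<^sup>2 / 2 \<le> cmod ?f" using complex_Re_le_cmod[of ?f] by simp
  then have "sqrt (2 * (cmod w)\<^sup>2) \<le> sqrt (2 * cmod ?f + (cmod w)\<^sup>2)" by simp
  moreover have "dcyg (Complex 0 t, 0) (z, w) = sqrt (2 * cmod ?f + (cmod w)\<^sup>2)"
    by (simp add: dcyg_def cyg_gauge_def qmult_def qinv_def)
  ultimately have d: "sqrt 2 * cmod w \<le> dcyg (Complex 0 t, 0) (z, w)"
    by (simp add: real_sqrt_mult)
  have "1 \<le> cmod (q * w)" using q assms by (intro gauss_int_norm_ge_1) auto
  then have "sqrt 2 * 1 \<le> sqrt 2 * (cmod q * cmod w)"
    by (intro mult_left_mono) (auto simp: norm_mult)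
  also have "\<dots> = cmod q * (sqrt 2 * cmod w)" by simp
  also have "\<dots> \<le> cmod q * dcyg (Complex 0 t, 0) (z, w)" using d by (intro mult_left_mono) auto
  finally show ?thesis unfolding h by simp
qed

lemma on_chain_cases:
  assumes "(z, 0) \<in> QQ"
  obtains a b :: int where "0 < b" "coprime a b" "z = Complex 0 (of_int a / of_int b)"
proof -
  have "Im z \<in> \<rat>" "Re z = 0" using assms by (auto simp: QQ_def QR_def gauss_rat_def)
  then obtain a b :: int where "0 < b" "coprime a b" "Im z = of_int a / of_int b"
    by (metis Rats_cases')
  then show ?thesis using \<open>Re z = 0\<close> by (intro that[of b a]) (auto simp: complex_eq_iff)
qed

text \<open>Reduced fractions on the chain give the upper bound. For the lower bound, points off the
  chain contribute at least \<open>sqrt 2\<close>, which dominates \<open>sqrt (2 * \<mu>)\<close>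
  since \<open>\<mu> \<le> 1\<close>.\<close>

lemma lag_c_chain:
  assumes \<mu>: "has_lagrange_value t \<mu>" "0 \<le> \<mu>" "\<mu> \<le> 1"
  shows "lag_c (Complex 0 t, 0) = ereal (sqrt (2 * \<mu>))"
proof (rule antisym)
  let ?x = "(Complex 0 t, 0 :: complex)" and ?c = "sqrt (2 * \<mu>)"
  let ?I = "\<lambda>T. INF r \<in> {r \<in> QQ. height r \<ge> T}. ereal (height r * dcyg ?x r)"
  have c: "0 \<le> ?c" "?c\<^sup>2 = 2 * \<mu>" using \<mu> by auto
  have "?I T \<le> ereal ?c" for T
  proof (rule ereal_le_epsilon2)
    fix e :: real assume e: "0 < e"
    have "?c\<^sup>2 < (?c + e)\<^sup>2" using c e by (intro power_strict_mono) auto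
    then have "\<mu> < (?c + e)\<^sup>2 / 2" using c by simp
    then obtain a b :: int where ab: "0 < b" "\<lceil>T\<rceil> \<le> b" "coprime a b"
      "of_int b * \<bar>of_int b * t - of_int a\<bar> \<le> (?c + e)\<^sup>2 / 2"
      using \<mu> unfolding has_lagrange_value_def by metis
    let ?r = "(Complex 0 (of_int a / of_int b), 0 :: complex)"
    note r = chain_point[OF ab(1,3)]
    have "height ?r * dcyg ?x ?r \<le> sqrt ((?c + e)\<^sup>2)"
      unfolding r(3) using ab(4) by (intro real_sqrt_le_mono) simp
    also have "\<dots> = ?c + e" using c e by simp
    finally have "ereal (height ?r * dcyg ?x ?r) \<le> ereal ?c + ereal e" by simp
    moreover have "?r \<in> {r \<in> QQ. height r \<ge> T}" using r ab(2) by (simp add: ceiling_le_iff)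
    ultimately show "?I T \<le> ereal ?c + ereal e" by (rule INF_lower2[rotated])
  qed
  then show "lag_c ?x \<le> ereal ?c" unfolding lag_c_def by (rule SUP_least)
  show "ereal ?c \<le> lag_c ?x"
  proof (rule ereal_le_epsilon2)
    fix e :: real assume e: "0 < e"
    have "\<exists>B::int. \<forall>a b. 0 < b \<longrightarrow> B \<le> b \<longrightarrow> ?c - e \<le> sqrt (2 * (of_int b * \<bar>of_int b * t - of_int a\<bar>))"
    proof (cases "?c - e \<le> 0")
      \<comment> \<open>Squaring would not preserve the order here, but the right side is
        nonnegative.\<close>
      case True
      have "?c - e \<le> sqrt (2 * (of_int b * \<bar>of_int b * t - of_int a\<bar>))" if "0 < b" for a b :: int
        using that by (intro order.trans[OF True]) simp
      then show ?thesis by blast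
    next
      case False
      then have "(?c - e)\<^sup>2 < ?c\<^sup>2" using e by (intro power_strict_mono) auto
      then have "(?c - e)\<^sup>2 / 2 < \<mu>" using c by simp
      then obtain B :: int where B: "\<And>a b. 0 < b \<Longrightarrow> B \<le> b \<Longrightarrow> (?c - e)\<^sup>2 / 2 \<le> of_int b * \<bar>of_int b * t - of_int a\<bar>"
        using \<mu> unfolding has_lagrange_value_def by metis
      have "?c - e \<le> sqrt (2 * (of_int b * \<bar>of_int b * t - of_int a\<bar>))" if "0 < b" "B \<le> b" for a b :: int
        using B[OF that, of a] by (intro real_le_rsqrt) simp
      then show ?thesis by blast
    qed
    then obtain B :: int where B: "\<And>a b. 0 < b \<Longrightarrow> B \<le> b \<Longrightarrow> ?c - e \<le> sqrt (2 * (of_int b * \<bar>of_int b * t - of_int a\<bar>))"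
      by blast
    have "ereal (?c - e) \<le> ?I (of_int B)"
    proof (rule INF_greatest)
      fix r assume r: "r \<in> {r \<in> QQ. of_int B \<le> height r}"
      obtain z w where zw: "r = (z, w)" by (cases r)
      show "ereal (?c - e) \<le> ereal (height r * dcyg ?x r)"
      proof (cases "w = 0")
        case True
        then obtain a b :: int where ab: "0 < b" "coprime a b" "z = Complex 0 (of_int a / of_int b)"
          using r on_chain_cases zw by blast
        note cp = chain_point[OF ab(1,2)]
        have "B \<le> b" using r cp(2) unfolding zw True ab(3) by simp
        then show ?thesis using B[OF ab(1), of a] cp(3) unfolding zw True ab(3) by simp
      next
        case False
        then have "sqrt 2 \<le> height r * dcyg ?x r" using off_chain_point r zw by blast
        moreover have "?c \<le> sqrt 2" using \<mu> by simp
        ultimately have "?c - e \<le> height r * dcyg ?x r" using e by linarith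
        then show ?thesis by simp
      qed
    qed
    also have "\<dots> \<le> lag_c ?x" unfolding lag_c_def by (rule SUP_upper) simp
    finally show "ereal ?c \<le> lag_c ?x + ereal e" by (cases "lag_c ?x") auto
  qed
qed

theorem theorem1p8:
  shows "{0..(0.047::real)} \<subseteq> Sp_Lag"
proof
  fix c :: real assume c: "c \<in> {0..0.047}"
  then have "c\<^sup>2 \<le> 0.047\<^sup>2" by (intro power_mono) auto
  \<comment> \<open>Solving \<open>c = sqrt (2 * \<mu>)\<close> gives
    \<open>\<mu> = c\<^sup>2 / 2\<close>, here below 0.0012.\<close>
  then have \<mu>: "0 \<le> c\<^sup>2 / 2" "c\<^sup>2 / 2 \<le> 1 / 74" by (auto simp: power2_eq_square)
  then obtain t where t: "t \<notin> \<rat>" "has_lagrange_value t (c\<^sup>2 / 2)"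
    using exists_lagrange_value by blast
  have "lag_c (Complex 0 t, 0) = ereal (sqrt (2 * (c\<^sup>2 / 2)))"
    using t \<mu> by (intro lag_c_chain) auto
  also have "\<dots> = ereal c" using c by simp
  finally have "lag_c (Complex 0 t, 0) = ereal c" .
  moreover have "(Complex 0 t, 0) \<in> QR - QQ"
    using t by (auto simp: QR_def QQ_def gauss_rat_def)
  ultimately show "c \<in> Sp_Lag" unfolding Sp_Lag_def by blast
qed

end
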